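(* Let $w\,\Psi^{-1}(E(\Psi(u)))\in L^{\infty}(\Sigma)$, let $E(wu)$ be bounded away from zero, and let $T=M_wEM_u$ be the WCT operator on the Orlicz space $L^\Phi(\Sigma)$. Then the descent of $T$ satisfies $\delta(T)\le 2$.
   Context: $(X,\Sigma,\mu)$ is a complete $\sigma$-finite measure space; functions are identified when equal $\mu$-a.e. A Young function is a convex even function $\Phi:\mathbb{R}\to[0,\infty]$ with $\Phi(0)=0$, neither identically $0$ nor identically $\infty$ on $(0,\infty)$, and left-continuous at $b_\Phi=\sup\{x>0:\Phi(x)<\infty\}$. Its complementary function is $\Psi(y)=\sup\{x|y|-\Phi(x):x\ge 0\}$; $(\Phi,\Psi)$ is such a pair of complementary Young functions. For a measurable function $f$, $\Phi(f)$ means $\Phi(|f|)$, and similarly for $\Psi$. The generalized inverse is $\Psi^{-1}(y)=\inf\{x\ge0:\Psi(x)>y\}$. The Orlicz space is $L^\Phi(\mu)=L^\Phi(\Sigma)=\{f \text{ measurable}: \exists k>0,\ \int_X\Phi(kf)\,d\mu<\infty\}$, with norm $N_\Phi(f)=\inf\{k>0:\int_X\Phi(f/k)\,d\mu\le1\}$. $\mathcal{A}\subseteq\Sigma$ is a $\sigma$-finite sub-$\sigma$-algebra and $E=E^{\mathcal A}$ is the associated conditional expectation: $E(f)$ is the unique $\mathcal A$-measurable function with $\int_A f\,d\mu=\int_A E(f)\,d\mu$ for all $A\in\mathcal A$. For measurable $u,w:X\to\mathbb{C}$, the weighted conditional type (WCT) operator $T=M_wEM_u$ from $L^\Phi(\Sigma)$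 into $L^\Phi(\Sigma)$ is defined by $T(f)=wE(uf)$ for every $f\in L^\Phi(\Sigma)$ such that $wE(uf)\in L^\Phi(\Sigma)$; the conditional expectations appearing are understood to be defined. That $E(wu)$ is bounded away from zero means that there is $\delta_0>0$ with $|E(wu)|\ge\delta_0$ $\mu$-a.e. on the support $S(E(wu))=\{x\in X: E(wu)(x)\neq0\}$. $\mathcal{R}(S)$ denotes the range of an operator $S$. The descent $\delta(S)$ is the smallest non-negative integer $k$ with $\mathcal{R}(S^k)=\mathcal{R}(S^{k+1})$ ($\delta(S)=\infty$ if there is none). *)

theory Defs
  imports "HOL-Probability.Probability"
begin

definition young_bound :: "(real \<Rightarrow> ennreal) \<Rightarrow> ereal" where
  "young_bound \<Phi> = (SUP x \<in> {x. 0 < x \<and> \<Phi> x < \<infinity>}. ereal x)"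

text \<open>Library convexity is for vector-valued maps, so the convexity inequality is written out
  for values in \<open>[0, \<infinity>]\<close>. Left-continuity at \<^term>\<open>young_bound \<Phi>\<close> is a condition only
  if that bound is finite.\<close>

definition young_function :: "(real \<Rightarrow> ennreal) \<Rightarrow> bool" where
  "young_function \<Phi> \<longleftrightarrow>
     (\<forall>x y t. 0 \<le> t \<and> t \<le> 1 \<longrightarrow>
        \<Phi> ((1 - t) * x + t * y) \<le> ennreal (1 - t) * \<Phi> x + ennreal t * \<Phi> y) \<and>
     (\<forall>x. \<Phi> (- x) = \<Phi> x) \<and>
     \<Phi> 0 = 0 \<and>
     (\<exists>x>0. \<Phi> x \<noteq> 0) \<and>
     (\<exists>x>0. \<Phi> x \<noteq> \<infinity>) \<and>
     (\<forall>b. young_bound \<Phi> = ereal b \<longrightarrow> continuous (at_left b) \<Phi>)"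

text \<open>Subtraction on \<^typ>\<open>ennreal\<close> is truncated at \<open>0\<close>. This does not change the supremum,
  because \<open>x = 0\<close> contributes \<open>0\<close> to it.\<close>

definition complementary :: "(real \<Rightarrow> ennreal) \<Rightarrow> real \<Rightarrow> ennreal" where
  "complementary \<Phi> y = (SUP x \<in> {0..}. ennreal (x * \<bar>y\<bar>) - \<Phi> x)"

text \<open>In particular the value is \<open>\<infinity>\<close> where the set is empty, e.g. at \<open>y = \<infinity>\<close>.
  Products with such values follow the \<^typ>\<open>ennreal\<close> convention \<open>0 * \<infinity> = 0\<close>, so if
  \<open>wg\<close> is essentially bounded then \<open>w = 0\<close> a.e. on \<open>{g = \<infinity>}\<close>.\<close>

definition gen_inverse :: "(real \<Rightarrow> ennreal) \<Rightarrow> ennreal \<Rightarrow> ennreal" where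
  "gen_inverse \<Psi> y = (INF x \<in> {x. 0 \<le> x \<and> \<Psi> x > y}. ennreal x)"

definition orlicz_functions :: "(real \<Rightarrow> ennreal) \<Rightarrow> 'a measure \<Rightarrow> ('a \<Rightarrow> complex) set" where
  "orlicz_functions \<Phi> M =
     {f \<in> borel_measurable M. \<exists>k>0. (\<integral>\<^sup>+ x. \<Phi> (k * cmod (f x)) \<partial>M) < \<infinity>}"

definition ae_rel :: "'a measure \<Rightarrow> (('a \<Rightarrow> complex) \<times> ('a \<Rightarrow> complex)) set" where
  "ae_rel M = {(f, g). f \<in> borel_measurable M \<and> g \<in> borel_measurable M \<and> (AE x in M. f x = g x)}"

definition ae_class :: "'a measure \<Rightarrow> ('a \<Rightarrow> complex) \<Rightarrow> ('a \<Rightarrow> complex) set" where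
  "ae_class M f = ae_rel M `` {f}"

definition orlicz_space :: "(real \<Rightarrow> ennreal) \<Rightarrow> 'a measure \<Rightarrow> ('a \<Rightarrow> complex) set set" where
  "orlicz_space \<Phi> M = orlicz_functions \<Phi> M // ae_rel M"

text \<open>The library has conditional expectation for \<open>[0, \<infinity>]\<close>-valued and for real functions.
  A complex function \<open>f\<close> has a (finite) conditional expectation iff \<open>E(\<bar>f\<bar>) < \<infinity>\<close> a.e.;
  it need not be integrable over the whole space.\<close>

definition has_cond_exp :: "'a measure \<Rightarrow> 'a measure \<Rightarrow> ('a \<Rightarrow> complex) \<Rightarrow> bool" where
  "has_cond_exp M F f \<longleftrightarrow>
     f \<in> borel_measurable M \<and> (AE x in M. nn_cond_exp M F (\<lambda>x. ennreal (cmod (f x))) x < \<infinity>)"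

definition complex_cond_exp :: "'a measure \<Rightarrow> 'a measure \<Rightarrow> ('a \<Rightarrow> complex) \<Rightarrow> 'a \<Rightarrow> complex" where
  "complex_cond_exp M F f x =
     Complex (real_cond_exp M F (\<lambda>x. Re (f x)) x) (real_cond_exp M F (\<lambda>x. Im (f x)) x)"

definition wct :: "'a measure \<Rightarrow> 'a measure \<Rightarrow> ('a \<Rightarrow> complex) \<Rightarrow> ('a \<Rightarrow> complex) \<Rightarrow>
    ('a \<Rightarrow> complex) \<Rightarrow> 'a \<Rightarrow> complex" where
  "wct M F w u f = (\<lambda>x. w x * complex_cond_exp M F (\<lambda>x. u x * f x) x)"

text \<open>The operator as a (possibly partial) operator on the Orlicz space, given by its graph. Its
  domain consists of the classes of those \<open>f\<close> for which \<open>E(uf)\<close> is defined and \<open>wE(uf)\<close> is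
  again in the Orlicz space.\<close>

definition wct_operator :: "(real \<Rightarrow> ennreal) \<Rightarrow> 'a measure \<Rightarrow> 'a measure \<Rightarrow>
    ('a \<Rightarrow> complex) \<Rightarrow> ('a \<Rightarrow> complex) \<Rightarrow> (('a \<Rightarrow> complex) set \<times> ('a \<Rightarrow> complex) set) set" where
  "wct_operator \<Phi> M F w u =
     {(ae_class M f, ae_class M (wct M F w u f)) | f.
        f \<in> orlicz_functions \<Phi> M \<and> has_cond_exp M F (\<lambda>x. u x * f x) \<and>
        wct M F w u f \<in> orlicz_functions \<Phi> M}"

text \<open>For an operator \<open>S\<close> on \<open>V\<close>, given by its graph, the range of \<open>S\<^sup>k\<close> (on its natural domain)
  is the image of \<open>V\<close> under the relational power; for \<open>k = 0\<close> this is \<open>V\<close>. In \<^typ>\<open>enat\<close> the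
  infimum of the empty set is \<open>\<infinity>\<close>.\<close>

definition range_power :: "'v set \<Rightarrow> ('v \<times> 'v) set \<Rightarrow> nat \<Rightarrow> 'v set" where
  "range_power V S k = (S ^^ k) `` V"

definition descent :: "'v set \<Rightarrow> ('v \<times> 'v) set \<Rightarrow> enat" where
  "descent V S = (INF k \<in> {k. range_power V S k = range_power V S (Suc k)}. enat k)"

end

theory Submission
  imports Defs
begin

text \<open>Write \<open>m = E(wu)\<close>. The inclusion \<open>\<R>(T\<^sup>3) \<subseteq> \<R>(T\<^sup>2)\<close> always holds, so the task is to find, for
  every \<open>f\<close> in the domain of \<open>T\<^sup>2\<close>, a function \<open>h\<close> with \<open>T\<^sup>3 h = T\<^sup>2 f\<close>.

  Let \<open>a = E(uf)\<close>. Then \<open>T f = wa\<close> with \<open>a\<close> measurable for the subalgebra. On functions \<open>wb\<close> of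
  this shape, \<open>T\<close> is multiplication by \<open>m\<close>: the factor \<open>b\<close> can be pulled out of the conditional
  expectation, so \<open>T(wb) = w E(b uw) = wbm\<close>. In particular \<open>T\<^sup>2 f = wam\<close>. Hence
  \<open>h = wa / m\<^sup>2\<close>, read as \<open>0\<close> where \<open>m = 0\<close>, has the iterates
  \<open>T h = wa / m\<close>, \<open>T\<^sup>2 h = wa\<close> on the support of \<open>m\<close> and \<open>0\<close> elsewhere, and
  \<open>T\<^sup>3 h = wam = T\<^sup>2 f\<close>.
  As \<open>m\<close> is bounded away from zero on its support, \<open>h\<close> and its first two iterates are \<open>wa\<close> times
  bounded functions and so stay in the Orlicz space, which is solid; the third iterate lies there
  because \<open>T\<^sup>2 f\<close> does. The same three bounds give the existence of the conditional expectations
  of \<open>u\<close> times these functions from that of \<open>E(u \<cdot> wa)\<close>, which is part of \<open>f\<close> being in the domain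
  of \<open>T\<^sup>2\<close>.

  The pull-out property (\<open>complex_cond_exp_pull_out\<close>) is needed for functions that have a finite
  conditional expectation without being integrable.  It is derived from the
  \<open>[0, \<infinity>]\<close>-valued theory, by splitting into positive and negative parts.\<close>

section \<open>Conditional expectations of functions that need not be integrable\<close>

context sigma_finite_subalgebra
begin

text \<open>All conditional expectations involved are finite almost everywhere, so that the identity
  can be read off from the rearrangement
  \<open>(f - g)\<^sup>+ + f\<^sup>- + g\<^sup>+ = (f - g)\<^sup>- + f\<^sup>+ + g\<^sup>-\<close>. Its terms are nonnegative, and additivity of
  the \<open>[0, \<infinity>]\<close>-valued conditional expectation applies to it.\<close>

lemma real_cond_exp_diff_finite:
  assumes [measurable]: "f \<in> borel_measurable M" "g \<in> borel_measurable M"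
    and ff: "AE x in M. nn_cond_exp M F (\<lambda>x. ennreal \<bar>f x\<bar>) x < \<infinity>"
    and fg: "AE x in M. nn_cond_exp M F (\<lambda>x. ennreal \<bar>g x\<bar>) x < \<infinity>"
  shows "AE x in M. real_cond_exp M F (\<lambda>x. f x - g x) x
           = real_cond_exp M F f x - real_cond_exp M F g x"
proof -
  let ?N = "nn_cond_exp M F"
  define p where "p = (\<lambda>x. ennreal (f x - g x))"
  define n where "n = (\<lambda>x. ennreal (- (f x - g x)))"
  define fp where "fp = (\<lambda>x. ennreal (f x))"
  define fn where "fn = (\<lambda>x. ennreal (- f x))"
  define gp where "gp = (\<lambda>x. ennreal (g x))"
  define gn where "gn = (\<lambda>x. ennreal (- g x))"
  have [measurable]: "p \<in> borel_measurable M" "n \<in> borel_measurable M"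
    "fp \<in> borel_measurable M" "fn \<in> borel_measurable M"
    "gp \<in> borel_measurable M" "gn \<in> borel_measurable M"
    unfolding p_def n_def fp_def fn_def gp_def gn_def by measurable
  have pointwise: "(\<lambda>x. p x + (fn x + gp x)) = (\<lambda>x. n x + (fp x + gn x))"
  proof
    fix x
    have pos: "ennreal a + (ennreal b + ennreal c) = ennreal (max 0 a + (max 0 b + max 0 c))" for a b c
      by simp
    show "p x + (fn x + gp x) = n x + (fp x + gn x)"
      unfolding p_def n_def fp_def fn_def gp_def gn_def pos
      by (rule arg_cong[where f = ennreal]) (auto simp: max_def)
  qed
  have f_parts: "AE x in M. ?N fp x \<le> ?N (\<lambda>x. ennreal \<bar>f x\<bar>) x"
      "AE x in M. ?N fn x \<le> ?N (\<lambda>x. ennreal \<bar>f x\<bar>) x"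
    by (intro nn_cond_exp_mono; auto simp: fp_def fn_def intro!: ennreal_leI)+
  have g_parts: "AE x in M. ?N gp x \<le> ?N (\<lambda>x. ennreal \<bar>g x\<bar>) x"
      "AE x in M. ?N gn x \<le> ?N (\<lambda>x. ennreal \<bar>g x\<bar>) x"
    by (intro nn_cond_exp_mono; auto simp: gp_def gn_def intro!: ennreal_leI)+
  have "p x \<le> fp x + gn x" "n x \<le> fn x + gp x" for x
    unfolding p_def n_def fp_def fn_def gp_def gn_def
    by (cases "f x \<le> 0"; cases "g x \<le> 0";
        auto simp: ennreal_neg simp flip: ennreal_plus intro!: ennreal_leI)+
  then have pn_parts: "AE x in M. ?N p x \<le> ?N (\<lambda>x. fp x + gn x) x"
      "AE x in M. ?N n x \<le> ?N (\<lambda>x. fn x + gp x) x"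
    by (intro nn_cond_exp_mono; auto)+
  have sums: "AE x in M. ?N fp x + ?N gn x = ?N (\<lambda>x. fp x + gn x) x"
      "AE x in M. ?N fn x + ?N gp x = ?N (\<lambda>x. fn x + gp x) x"
      "AE x in M. ?N p x + ?N (\<lambda>x. fn x + gp x) x = ?N (\<lambda>x. p x + (fn x + gp x)) x"
      "AE x in M. ?N n x + ?N (\<lambda>x. fp x + gn x) x = ?N (\<lambda>x. n x + (fp x + gn x)) x"
    by (intro nn_cond_exp_sum; measurable)+
  show ?thesis
    using ff fg f_parts g_parts pn_parts sums
  proof eventually_elim
    case (elim x)
    have fin: "?N fp x < \<infinity>" "?N fn x < \<infinity>" "?N gp x < \<infinity>" "?N gn x < \<infinity>"
      using elim(1-6) by (auto intro: le_less_trans)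
    then have finpn: "?N p x < \<infinity>" "?N n x < \<infinity>"
      using elim(7-10) by (metis ennreal_add_less_top infinity_ennreal_def le_less_trans)+
    have "?N p x + (?N fn x + ?N gp x) = ?N n x + (?N fp x + ?N gn x)"
      using elim(9-12) pointwise by simp
    then have "enn2real (?N p x + (?N fn x + ?N gp x)) = enn2real (?N n x + (?N fp x + ?N gn x))"
      by simp
    then have "enn2real (?N p x) + (enn2real (?N fn x) + enn2real (?N gp x)) =
        enn2real (?N n x) + (enn2real (?N fp x) + enn2real (?N gn x))"
      using fin finpn by (simp add: enn2real_plus)
    then show ?case
      unfolding real_cond_exp_def p_def n_def fp_def fn_def gp_def gn_def by simp
  qed
qed

text \<open>The identity even holds where the conditional expectations of \<open>f\<^sup>+\<close> and \<open>f\<^sup>-\<close> are infinite: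
  at each point at most one of the parts \<open>b\<^sup>+\<close>, \<open>b\<^sup>-\<close> is nonzero, so no sum of two nonzero terms
  has to be split, and \<^const>\<open>enn2real\<close> is multiplicative also at \<open>\<infinity>\<close>.\<close>

lemma real_cond_exp_pull_out:
  assumes bF [measurable]: "b \<in> borel_measurable F" and [measurable]: "f \<in> borel_measurable M"
  shows "AE x in M. real_cond_exp M F (\<lambda>x. b x * f x) x = b x * real_cond_exp M F f x"
proof -
  let ?N = "nn_cond_exp M F"
  have [measurable]: "b \<in> borel_measurable M"
    by (rule measurable_from_subalg[OF subalg bF])
  define bp where "bp = (\<lambda>x. ennreal (b x))"
  define bn where "bn = (\<lambda>x. ennreal (- b x))"
  have [measurable]: "bp \<in> borel_measurable F" "bn \<in> borel_measurable F"
      "bp \<in> borel_measurable M" "bn \<in> borel_measurable M"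
    unfolding bp_def bn_def by measurable
  have part: "AE x in M. ?N (\<lambda>x. ennreal (b x * g x)) x
      = bp x * ?N (\<lambda>x. ennreal (g x)) x + bn x * ?N (\<lambda>x. ennreal (- g x)) x"
    if [measurable]: "g \<in> borel_measurable M" for g
  proof -
    have "(\<lambda>x. ennreal (b x * g x)) = (\<lambda>x. bp x * ennreal (g x) + bn x * ennreal (- g x))"
    proof
      fix x
      show "ennreal (b x * g x) = bp x * ennreal (g x) + bn x * ennreal (- g x)"
      proof (cases "b x \<ge> 0")
        case True
        then show ?thesis by (simp add: bp_def bn_def ennreal_neg ennreal_mult')
      next
        case False
        then have "ennreal (- b x * - g x) = ennreal (- b x) * ennreal (- g x)"
          by (intro ennreal_mult') simp
        with False show ?thesis by (simp add: bp_def bn_def ennreal_neg)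
      qed
    qed
    moreover have "AE x in M. ?N (\<lambda>x. bp x * ennreal (g x)) x + ?N (\<lambda>x. bn x * ennreal (- g x)) x
        = ?N (\<lambda>x. bp x * ennreal (g x) + bn x * ennreal (- g x)) x"
      by (rule nn_cond_exp_sum) measurable
    moreover have "AE x in M. bp x * ?N (\<lambda>x. ennreal (g x)) x = ?N (\<lambda>x. bp x * ennreal (g x)) x"
        "AE x in M. bn x * ?N (\<lambda>x. ennreal (- g x)) x = ?N (\<lambda>x. bn x * ennreal (- g x)) x"
      by (rule nn_cond_exp_prod; measurable)+
    ultimately show ?thesis by auto
  qed
  have "(\<lambda>x. - f x) \<in> borel_measurable M" by measurable
  from part[OF \<open>f \<in> borel_measurable M\<close>] part[OF this] show ?thesis
  proof eventually_elim
    case (elim x)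
    then show ?case
      by (cases "b x \<ge> 0")
        (simp_all add: real_cond_exp_def bp_def bn_def ennreal_neg enn2real_mult algebra_simps)
  qed
qed

lemma complex_cond_exp_measurable [measurable]:
  "complex_cond_exp M F f \<in> borel_measurable F"
proof -
  have "complex_cond_exp M F f = (\<lambda>x. complex_of_real (real_cond_exp M F (\<lambda>x. Re (f x)) x)
      + \<i> * complex_of_real (real_cond_exp M F (\<lambda>x. Im (f x)) x))"
    by (simp add: fun_eq_iff complex_cond_exp_def Complex_eq)
  then show ?thesis by simp
qed

lemma complex_cond_exp_measurable' [measurable]:
  "complex_cond_exp M F f \<in> borel_measurable M"
  by (rule measurable_from_subalg[OF subalg complex_cond_exp_measurable])

lemma complex_cond_exp_cong:
  assumes "AE x in M. f x = g x" and [measurable]: "f \<in> borel_measurable M" "g \<in> borel_measurable M"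
  shows "AE x in M. complex_cond_exp M F f x = complex_cond_exp M F g x"
proof -
  have "AE x in M. real_cond_exp M F (\<lambda>x. Re (f x)) x = real_cond_exp M F (\<lambda>x. Re (g x)) x"
    "AE x in M. real_cond_exp M F (\<lambda>x. Im (f x)) x = real_cond_exp M F (\<lambda>x. Im (g x)) x"
    using assms(1) by (intro real_cond_exp_cong; auto)+
  then show ?thesis by (auto simp: complex_cond_exp_def)
qed

lemma has_cond_exp_dominated:
  assumes f: "has_cond_exp M F f" and [measurable]: "g \<in> borel_measurable M"
    and le: "AE x in M. cmod (g x) \<le> K * cmod (f x)" and K: "0 \<le> K"
  shows "has_cond_exp M F g"
proof -
  have [measurable]: "f \<in> borel_measurable M" using f by (simp add: has_cond_exp_def)
  have "AE x in M. nn_cond_exp M F (\<lambda>x. ennreal (cmod (g x))) x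
      \<le> nn_cond_exp M F (\<lambda>x. ennreal K * ennreal (cmod (f x))) x"
    using le by (intro nn_cond_exp_mono) (auto simp: K simp flip: ennreal_mult' intro: ennreal_leI)
  moreover have "AE x in M. ennreal K * nn_cond_exp M F (\<lambda>x. ennreal (cmod (f x))) x
      = nn_cond_exp M F (\<lambda>x. ennreal K * ennreal (cmod (f x))) x"
    by (rule nn_cond_exp_prod) auto
  moreover have "AE x in M. nn_cond_exp M F (\<lambda>x. ennreal (cmod (f x))) x < \<infinity>"
    using f by (simp add: has_cond_exp_def)
  ultimately have "AE x in M. nn_cond_exp M F (\<lambda>x. ennreal (cmod (g x))) x < \<infinity>"
  proof eventually_elim
    case (elim x)
    have "ennreal K * nn_cond_exp M F (\<lambda>x. ennreal (cmod (f x))) x < \<infinity>"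
      using elim(3) by (simp add: ennreal_mult_less_top)
    then show ?case using elim(1,2) by (simp add: le_less_trans)
  qed
  then show ?thesis by (simp add: has_cond_exp_def)
qed

lemma has_cond_exp_real_part_finite:
  assumes p: "has_cond_exp M F p" and [measurable]: "f \<in> borel_measurable M"
    and le: "\<And>x. \<bar>f x\<bar> \<le> cmod (p x)"
  shows "AE x in M. nn_cond_exp M F (\<lambda>x. ennreal \<bar>f x\<bar>) x < \<infinity>"
  using has_cond_exp_dominated[OF p, of "\<lambda>x. complex_of_real (f x)" 1] le
  by (simp add: has_cond_exp_def)

text \<open>The real part of \<open>bp\<close> is the difference of \<open>Re b Re p\<close> and \<open>Im b Im p\<close>. Both are dominated
  by \<open>\<bar>bp\<bar>\<close>, as are the two terms of the imaginary part,
  so finiteness of \<open>E(\<bar>bp\<bar>)\<close> suffices for splitting the difference; \<open>p\<close> itself may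
  fail to have a conditional expectation on \<open>{b = 0}\<close>.\<close>

lemma complex_cond_exp_pull_out:
  assumes bF [measurable]: "b \<in> borel_measurable F" and [measurable]: "p \<in> borel_measurable M"
    and bp: "has_cond_exp M F (\<lambda>x. b x * p x)"
  shows "AE x in M. complex_cond_exp M F (\<lambda>x. b x * p x) x = b x * complex_cond_exp M F p x"
proof -
  have [measurable]: "b \<in> borel_measurable M"
    by (rule measurable_from_subalg[OF subalg bF])
  have bound: "\<bar>s * t\<bar> \<le> cmod (z * y)" if "\<bar>s\<bar> \<le> cmod z" "\<bar>t\<bar> \<le> cmod y" for s t z y
    using that by (simp add: abs_mult norm_mult mult_mono)
  note fin = has_cond_exp_real_part_finite[OF bp]
  have "AE x in M. real_cond_exp M F (\<lambda>x. Re (b x) * Re (p x) - Im (b x) * Im (p x)) x =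
      real_cond_exp M F (\<lambda>x. Re (b x) * Re (p x)) x - real_cond_exp M F (\<lambda>x. Im (b x) * Im (p x)) x"
    by (intro real_cond_exp_diff_finite fin bound abs_Re_le_cmod abs_Im_le_cmod) measurable
  moreover
  \<comment> \<open>The imaginary part of \<open>bp\<close> is a sum; the sign of \<open>Im b\<close> makes it a difference as well.\<close>
  have "AE x in M. real_cond_exp M F (\<lambda>x. Re (b x) * Im (p x) - (- Im (b x)) * Re (p x)) x =
      real_cond_exp M F (\<lambda>x. Re (b x) * Im (p x)) x - real_cond_exp M F (\<lambda>x. (- Im (b x)) * Re (p x)) x"
    by (intro real_cond_exp_diff_finite fin bound)
      (auto simp: abs_Re_le_cmod abs_Im_le_cmod)
  moreover have
    "AE x in M. real_cond_exp M F (\<lambda>x. Re (b x) * Re (p x)) x = Re (b x) * real_cond_exp M F (\<lambda>x. Re (p x)) x"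
    "AE x in M. real_cond_exp M F (\<lambda>x. Im (b x) * Im (p x)) x = Im (b x) * real_cond_exp M F (\<lambda>x. Im (p x)) x"
    "AE x in M. real_cond_exp M F (\<lambda>x. Re (b x) * Im (p x)) x = Re (b x) * real_cond_exp M F (\<lambda>x. Im (p x)) x"
    "AE x in M. real_cond_exp M F (\<lambda>x. (- Im (b x)) * Re (p x)) x = (- Im (b x)) * real_cond_exp M F (\<lambda>x. Re (p x)) x"
    by (intro real_cond_exp_pull_out; measurable)+
  ultimately show ?thesis
    by eventually_elim (simp add: complex_cond_exp_def complex_eq_iff)
qed

end

section \<open>Orlicz spaces are solid\<close>

lemma young_function_mono:
  assumes "young_function \<Phi>" "0 \<le> x" "x \<le> y"
  shows "\<Phi> x \<le> \<Phi> y"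
proof (cases "y = 0")
  case False
  with assms have y: "y > 0" by simp
  define t where "t = x / y"
  have t: "0 \<le> t" "t \<le> 1" using assms y by (simp_all add: t_def)
  with assms(1) have "\<Phi> ((1 - t) * 0 + t * y) \<le> ennreal (1 - t) * \<Phi> 0 + ennreal t * \<Phi> y"
    unfolding young_function_def by blast
  moreover have "\<Phi> 0 = 0" using assms(1) by (simp add: young_function_def)
  ultimately have "\<Phi> x \<le> ennreal t * \<Phi> y" using y by (simp add: t_def)
  also have "\<dots> \<le> 1 * \<Phi> y" using t by (intro mult_right_mono) auto
  finally show ?thesis by simp
qed (use assms in simp)

lemma orlicz_functions_dominated:
  assumes \<Phi>: "young_function \<Phi>" and f: "f \<in> orlicz_functions \<Phi> M"
    and g: "g \<in> borel_measurable M"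
    and le: "AE x in M. cmod (g x) \<le> K * cmod (f x)" and K: "0 < K"
  shows "g \<in> orlicz_functions \<Phi> M"
proof -
  from f obtain k where k: "k > 0" "(\<integral>\<^sup>+ x. \<Phi> (k * cmod (f x)) \<partial>M) < \<infinity>"
    by (auto simp: orlicz_functions_def)
  have "(\<integral>\<^sup>+ x. \<Phi> (k / K * cmod (g x)) \<partial>M) \<le> (\<integral>\<^sup>+ x. \<Phi> (k * cmod (f x)) \<partial>M)"
    using le
  proof (intro nn_integral_mono_AE, eventually_elim)
    case (elim x)
    then have "k / K * cmod (g x) \<le> k / K * (K * cmod (f x))"
      using k K by (intro mult_left_mono) auto
    then show ?case using k K by (intro young_function_mono[OF \<Phi>]) auto
  qed
  with k K g show ?thesis
    unfolding orlicz_functions_def by (auto intro!: exI[of _ "k / K"] elim: le_less_trans)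
qed

lemma orlicz_functions_cong:
  assumes "young_function \<Phi>" "f \<in> orlicz_functions \<Phi> M" "g \<in> borel_measurable M"
    and "AE x in M. f x = g x"
  shows "g \<in> orlicz_functions \<Phi> M"
  using assms(4) by (intro orlicz_functions_dominated[OF assms(1-3), of 1]) auto

lemma ae_class_eq_iff:
  assumes "f \<in> borel_measurable M" "g \<in> borel_measurable M"
  shows "ae_class M f = ae_class M g \<longleftrightarrow> (AE x in M. f x = g x)"
proof
  assume "ae_class M f = ae_class M g"
  moreover have "g \<in> ae_class M g" using assms by (simp add: ae_class_def ae_rel_def)
  ultimately have "g \<in> ae_class M f" by simp
  then show "AE x in M. f x = g x" by (simp add: ae_class_def ae_rel_def)
next
  assume "AE x in M. f x = g x"
  then show "ae_class M f = ae_class M g" using assms by (auto simp: ae_class_def ae_rel_def)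
qed

section \<open>The operator on multiples of the weight\<close>

text \<open>Regrouping \<open>u \<cdot> wb\<close> as \<open>b \<cdot> wu\<close> leaves a factor \<open>b\<close> that is measurable for the subalgebra
  and can be pulled out of the conditional expectation.\<close>

lemma wct_weight_multiple:
  assumes "sigma_finite_subalgebra M F"
    and "u \<in> borel_measurable M" "w \<in> borel_measurable M" "b \<in> borel_measurable F"
    and ce: "has_cond_exp M F (\<lambda>x. u x * (w x * b x))"
  shows "AE x in M. wct M F w u (\<lambda>x. w x * b x) x
           = w x * (b x * complex_cond_exp M F (\<lambda>x. w x * u x) x)"
proof -
  interpret sigma_finite_subalgebra M F by fact
  have eq: "(\<lambda>x. u x * (w x * b x)) = (\<lambda>x. b x * (w x * u x))" by (simp add: fun_eq_iff ac_simps)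
  have "AE x in M. complex_cond_exp M F (\<lambda>x. b x * (w x * u x)) x
      = b x * complex_cond_exp M F (\<lambda>x. w x * u x) x"
    using assms(2-4) ce unfolding eq by (intro complex_cond_exp_pull_out) auto
  then show ?thesis unfolding wct_def eq by auto
qed

lemma wct_operator_weight_multiple:
  assumes S: "sigma_finite_subalgebra M F" and \<Phi>: "young_function \<Phi>"
    and [measurable]: "u \<in> borel_measurable M" "w \<in> borel_measurable M"
    and b: "b \<in> borel_measurable F"
    and c: "\<And>x. c x = b x * complex_cond_exp M F (\<lambda>x. w x * u x) x"
    and ce: "has_cond_exp M F (\<lambda>x. u x * (w x * b x))"
    and wb: "(\<lambda>x. w x * b x) \<in> orlicz_functions \<Phi> M"
    and wc: "(\<lambda>x. w x * c x) \<in> orlicz_functions \<Phi> M"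
  shows "(ae_class M (\<lambda>x. w x * b x), ae_class M (\<lambda>x. w x * c x)) \<in> wct_operator \<Phi> M F w u"
proof -
  interpret sigma_finite_subalgebra M F by fact
  have ae: "AE x in M. wct M F w u (\<lambda>x. w x * b x) x = w x * c x"
    using wct_weight_multiple[OF S assms(3,4) b ce] by (simp add: c)
  have meas: "wct M F w u (\<lambda>x. w x * b x) \<in> borel_measurable M" unfolding wct_def by measurable
  have "(\<lambda>x. w x * c x) \<in> borel_measurable M" using wc by (simp add: orlicz_functions_def)
  then have "ae_class M (wct M F w u (\<lambda>x. w x * b x)) = ae_class M (\<lambda>x. w x * c x)"
    using meas ae by (simp add: ae_class_eq_iff)
  moreover have "wct M F w u (\<lambda>x. w x * b x) \<in> orlicz_functions \<Phi> M"
    using ae by (intro orlicz_functions_cong[OF \<Phi> wc meas]) auto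
  ultimately show ?thesis
    unfolding wct_operator_def using wb ce by blast
qed

section \<open>The range of the square and of the cube\<close>

text \<open>A pair in the graph of \<open>T\<^sup>2\<close> comes from a function \<open>f\<close> and from a representative \<open>f'\<close> of the
  class of \<open>T f\<close>, possibly different from \<open>T f\<close> itself. The pull-out property needs the
  representative \<open>wa\<close> with \<open>a = E(uf)\<close>, so the data about \<open>f'\<close> are transferred to it.\<close>

lemma wct_operator_square_value:
  assumes S: "sigma_finite_subalgebra M F" and \<Phi>: "young_function \<Phi>"
    and [measurable]: "u \<in> borel_measurable M" "w \<in> borel_measurable M"
    and "(v, y) \<in> wct_operator \<Phi> M F w u" "(y, z) \<in> wct_operator \<Phi> M F w u"
  obtains a where "a \<in> borel_measurable F"
    and "(\<lambda>x. w x * a x) \<in> orlicz_functions \<Phi> M"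
    and "has_cond_exp M F (\<lambda>x. u x * (w x * a x))"
    and "(\<lambda>x. w x * (a x * complex_cond_exp M F (\<lambda>x. w x * u x) x)) \<in> orlicz_functions \<Phi> M"
    and "z = ae_class M (\<lambda>x. w x * (a x * complex_cond_exp M F (\<lambda>x. w x * u x) x))"
proof -
  interpret sigma_finite_subalgebra M F by fact
  obtain f where y: "y = ae_class M (wct M F w u f)"
    and wf: "wct M F w u f \<in> orlicz_functions \<Phi> M"
    using assms(5) unfolding wct_operator_def by blast
  obtain f' where y': "y = ae_class M f'" and z: "z = ae_class M (wct M F w u f')"
    and f': "f' \<in> orlicz_functions \<Phi> M" and ce': "has_cond_exp M F (\<lambda>x. u x * f' x)"
    and wf': "wct M F w u f' \<in> orlicz_functions \<Phi> M"
    using assms(6) unfolding wct_operator_def by blast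
  define a where "a = complex_cond_exp M F (\<lambda>x. u x * f x)"
  define m where "m = complex_cond_exp M F (\<lambda>x. w x * u x)"
  have aF: "a \<in> borel_measurable F" unfolding a_def by measurable
  have [measurable]: "a \<in> borel_measurable M" "m \<in> borel_measurable M"
    unfolding a_def m_def by measurable
  have [measurable]: "f' \<in> borel_measurable M" using f' by (simp add: orlicz_functions_def)
  have wa: "wct M F w u f = (\<lambda>x. w x * a x)" by (simp add: wct_def a_def)
  have eq: "AE x in M. f' x = w x * a x"
    using y y' unfolding wa by (subst ae_class_eq_iff[symmetric]) auto
  have ce: "has_cond_exp M F (\<lambda>x. u x * (w x * a x))"
    using eq by (intro has_cond_exp_dominated[OF ce', of _ 1]) auto
  have "AE x in M. complex_cond_exp M F (\<lambda>x. u x * f' x) x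
      = complex_cond_exp M F (\<lambda>x. u x * (w x * a x)) x"
    using eq by (intro complex_cond_exp_cong) auto
  then have eq2: "AE x in M. wct M F w u f' x = w x * (a x * m x)"
    using wct_weight_multiple[OF S assms(3,4) aF ce] unfolding wct_def m_def by eventually_elim simp
  have meas: "wct M F w u f' \<in> borel_measurable M" using wf' by (simp add: orlicz_functions_def)
  show thesis
  proof
    show "a \<in> borel_measurable F" by fact
    show "(\<lambda>x. w x * a x) \<in> orlicz_functions \<Phi> M" using wf wa by simp
    show "has_cond_exp M F (\<lambda>x. u x * (w x * a x))" by fact
    show "(\<lambda>x. w x * (a x * complex_cond_exp M F (\<lambda>x. w x * u x) x)) \<in> orlicz_functions \<Phi> M"
      using orlicz_functions_cong[OF \<Phi> wf' _ eq2] by (simp add: m_def)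
    show "z = ae_class M (\<lambda>x. w x * (a x * complex_cond_exp M F (\<lambda>x. w x * u x) x))"
      unfolding z m_def[symmetric] using meas eq2 by (subst ae_class_eq_iff) auto
  qed
qed

lemma ae_class_in_orlicz_space:
  "f \<in> orlicz_functions \<Phi> M \<Longrightarrow> ae_class M f \<in> orlicz_space \<Phi> M"
  by (auto simp: orlicz_space_def ae_class_def intro: quotientI)

text \<open>In all quotients below division by zero gives \<open>0\<close>, so they vanish where \<open>E(wu)\<close> does and
  \<open>m / m\<close> is the indicator of the support.\<close>

lemma range_square_subset_range_cube:
  assumes S: "sigma_finite_subalgebra M F" and \<Phi>: "young_function \<Phi>"
    and [measurable]: "u \<in> borel_measurable M" "w \<in> borel_measurable M"
    and bdd: "0 < \<delta>" "AE x in M. complex_cond_exp M F (\<lambda>x. w x * u x) x \<noteq> 0 \<longrightarrow>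
           \<delta> \<le> cmod (complex_cond_exp M F (\<lambda>x. w x * u x) x)"
    and z: "z \<in> range_power (orlicz_space \<Phi> M) (wct_operator \<Phi> M F w u) 2"
  shows "z \<in> range_power (orlicz_space \<Phi> M) (wct_operator \<Phi> M F w u) 3"
proof -
  interpret sigma_finite_subalgebra M F by fact
  let ?T = "wct_operator \<Phi> M F w u"
  define m where "m = complex_cond_exp M F (\<lambda>x. w x * u x)"
  from z obtain v y where "(v, y) \<in> ?T" "(y, z) \<in> ?T"
    by (auto simp: range_power_def numeral_2_eq_2)
  then obtain a where aF [measurable]: "a \<in> borel_measurable F"
    and wa: "(\<lambda>x. w x * a x) \<in> orlicz_functions \<Phi> M"
    and ce: "has_cond_exp M F (\<lambda>x. u x * (w x * a x))"
    and wam: "(\<lambda>x. w x * (a x * m x)) \<in> orlicz_functions \<Phi> M"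
    and z_eq: "z = ae_class M (\<lambda>x. w x * (a x * m x))"
    unfolding m_def by (rule wct_operator_square_value[OF S \<Phi> assms(3,4)])
  have [measurable]: "a \<in> borel_measurable M" by (rule measurable_from_subalg[OF subalg aF])
  have mF [measurable]: "m \<in> borel_measurable F" unfolding m_def by measurable
  have [measurable]: "m \<in> borel_measurable M" by (rule measurable_from_subalg[OF subalg mF])
  have bounded_multiple: "(\<lambda>x. w x * (a x * c x)) \<in> orlicz_functions \<Phi> M"
      "has_cond_exp M F (\<lambda>x. u x * (w x * (a x * c x)))"
    if cF: "c \<in> borel_measurable F" and "0 < K" and c: "AE x in M. cmod (c x) \<le> K" for c K
  proof -
    have [measurable]: "c \<in> borel_measurable M" by (rule measurable_from_subalg[OF subalg cF])
    have "AE x in M. cmod (q x * c x) \<le> K * cmod (q x)" for q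
      using c by eventually_elim (simp add: norm_mult mult.commute[of _ "cmod (q _)"] mult_left_mono)
    from this[of "\<lambda>x. w x * a x"] this[of "\<lambda>x. u x * (w x * a x)"]
    show "(\<lambda>x. w x * (a x * c x)) \<in> orlicz_functions \<Phi> M"
      "has_cond_exp M F (\<lambda>x. u x * (w x * (a x * c x)))"
      using \<open>0 < K\<close>
      by (auto intro!: orlicz_functions_dominated[OF \<Phi> wa, of _ K] has_cond_exp_dominated[OF ce, of _ K]
          simp: mult.assoc)
  qed
  have inv: "AE x in M. cmod (1 / m x) \<le> 1 / \<delta>"
    using bdd(2) unfolding m_def[symmetric]
  proof eventually_elim
    case (elim x)
    then show ?case using bdd(1) by (cases "m x = 0") (auto simp: norm_divide frac_le)
  qed
  have inv2: "AE x in M. cmod (1 / m x * (1 / m x)) \<le> 1 / \<delta> * (1 / \<delta>)"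
    using inv
  proof eventually_elim
    case (elim x)
    then show ?case
      unfolding norm_mult by (intro mult_mono) (use bdd(1) in auto)
  qed
  have supp: "AE x in M. cmod (m x / m x) \<le> 1" by (simp add: norm_divide)
  note w2 = bounded_multiple[OF _ _ inv2]
  note w1 = bounded_multiple[OF _ _ inv]
  note w0 = bounded_multiple[OF _ _ supp]
  note step = wct_operator_weight_multiple[OF S \<Phi> assms(3,4)]
  define h where "h = ae_class M (\<lambda>x. w x * (a x * (1 / m x * (1 / m x))))"
  have "(h, ae_class M (\<lambda>x. w x * (a x * (1 / m x)))) \<in> ?T"
    unfolding h_def using w2 w1 bdd(1) by (intro step) (auto simp: m_def[symmetric])
  moreover have "(ae_class M (\<lambda>x. w x * (a x * (1 / m x))),
      ae_class M (\<lambda>x. w x * (a x * (m x / m x)))) \<in> ?T"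
    using w1 w0 bdd(1) by (intro step) (auto simp: m_def[symmetric])
  moreover have "(ae_class M (\<lambda>x. w x * (a x * (m x / m x))),
      ae_class M (\<lambda>x. w x * (a x * m x))) \<in> ?T"
    using w0 wam by (intro step) (auto simp: m_def[symmetric])
  moreover have "h \<in> orlicz_space \<Phi> M"
    unfolding h_def using w2(1) bdd(1) by (intro ae_class_in_orlicz_space) auto
  ultimately show ?thesis
    unfolding range_power_def z_eq numeral_3_eq_3 by (auto intro!: ImageI relcompI)
qed

lemma range_power_antimono:
  assumes "Range S \<subseteq> V"
  shows "range_power V S (Suc k) \<subseteq> range_power V S k"
  using assms unfolding range_power_def relpow.simps relpow_commute[symmetric] by blast

theorem corollary2p11:
  fixes M F :: "'a measure"
    and \<Phi> \<Psi> :: "real \<Rightarrow> ennreal"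
    and u w :: "'a \<Rightarrow> complex"
  assumes "complete_measure M"
    and "sigma_finite_measure M"
    and "sigma_finite_subalgebra M F"
    and "young_function \<Phi>"
    and "\<Psi> = complementary \<Phi>"
    and "u \<in> borel_measurable M"
    and "w \<in> borel_measurable M"
    and "esssup M (\<lambda>x. ennreal (cmod (w x)) *
           gen_inverse \<Psi> (nn_cond_exp M F (\<lambda>x. \<Psi> (cmod (u x))) x)) < \<infinity>"
    and "\<exists>\<delta>>0. AE x in M. complex_cond_exp M F (\<lambda>x. w x * u x) x \<noteq> 0 \<longrightarrow>
           \<delta> \<le> cmod (complex_cond_exp M F (\<lambda>x. w x * u x) x)"
  shows "descent (orlicz_space \<Phi> M) (wct_operator \<Phi> M F w u) \<le> 2"
proof -
  let ?V = "orlicz_space \<Phi> M" and ?T = "wct_operator \<Phi> M F w u"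
  have "Range ?T \<subseteq> ?V"
    by (auto simp: wct_operator_def intro: ae_class_in_orlicz_space)
  then have "range_power ?V ?T (Suc 2) \<subseteq> range_power ?V ?T 2"
    by (rule range_power_antimono)
  moreover have "range_power ?V ?T 2 \<subseteq> range_power ?V ?T (Suc 2)"
    using range_square_subset_range_cube[OF assms(3,4,6,7)] assms(9) by auto
  ultimately have "descent ?V ?T \<le> enat 2"
    unfolding descent_def by (intro INF_lower) auto
  then show ?thesis by (simp add: numeral_eq_enat)
qed

end
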